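(* Let $\mathbb{K}$ be a field of characteristic $0$. Let $b,g\in\mathbb{K}[[t]]$ have nonzero constant terms with $g$ even, $g(t)=\sum_{n\ge0}g_{2n}t^{2n}$, and let $f_1,f_2\in\mathbb{K}[[t]]$ be odd of order $1$, $f_i(t)=\sum_{n\ge0}f_{i,2n+1}t^{2n+1}$ with $f_{i,1}\neq0$. Let $D=(b|g;f_1,f_2)$ be the double almost-Riordan array. For $u(t)=\sum_{n\ge0}u_nt^n\in\mathbb{K}[[t]]$ let $v(t)$ denote the generating function of the column vector $D\,(u_0,u_1,u_2,\ldots)^T$ (written $D\,u(t)=v(t)$). (a) If $u$ is even, $u(t)=\sum_{k\ge0}u_{2k}t^{2k}$, then $$v(t)=u_0\,b(t)+\frac{t g(t)}{f_2(t)}\Big(u\big(\sqrt{f_1f_2}\big)-u_0\Big).$$ (b) If $u$ is odd, $u(t)=\sum_{k\ge0}u_{2k+1}t^{2k+1}$, then $$v(t)=\frac{t g(t)}{\sqrt{f_1f_2}}\,u\big(\sqrt{f_1f_2}\big).$$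
   Context: The double almost-Riordan array $(b|g;f_1,f_2)$ is the infinite lower triangular matrix $(d_{n,k})_{n,k\ge0}$ whose $k$-th column has generating function $\sum_{n}d_{n,k}t^n$ equal to $b$ for $k=0$, to $t g (f_1f_2)^{\ell}$ for $k=2\ell+1$, and to $t g f_1 (f_1f_2)^{\ell}$ for $k=2\ell+2$ ($\ell\ge0$); i.e. its columns are $(b,\ tg,\ tgf_1,\ tgf_1f_2,\ tgf_1^2f_2,\ tgf_1^2f_2^2,\ldots)$. Notation: for even $u$, $u(\sqrt{f_1f_2})$ means $\sum_{k\ge0}u_{2k}(f_1f_2)^k$, so that $\frac{tg}{f_2}(u(\sqrt{f_1f_2})-u_0)=tgf_1\sum_{k\ge1}u_{2k}(f_1f_2)^{k-1}$; for odd $u$, $\frac{1}{\sqrt{f_1f_2}}u(\sqrt{f_1f_2})$ means $\sum_{k\ge0}u_{2k+1}(f_1f_2)^k$. *)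

theory Defs
  imports "HOL-Computational_Algebra.Formal_Power_Series" "HOL-Library.Groups_Big_Fun"
begin

unbundle fps_syntax

definition fps_even :: "'a::zero fps \<Rightarrow> bool" where
  "fps_even u \<longleftrightarrow> (\<forall>n. odd n \<longrightarrow> u $ n = 0)"

definition fps_odd :: "'a::zero fps \<Rightarrow> bool" where
  "fps_odd u \<longleftrightarrow> (\<forall>n. even n \<longrightarrow> u $ n = 0)"

definition double_almost_riordan_column ::
    "'a::field fps \<Rightarrow> 'a fps \<Rightarrow> 'a fps \<Rightarrow> 'a fps \<Rightarrow> nat \<Rightarrow> 'a fps" where
  "double_almost_riordan_column b g f1 f2 k =
     (if k = 0 then b
      else if odd k then fps_X * g * (f1 * f2) ^ ((k - 1) div 2)
      else fps_X * g * f1 * (f1 * f2) ^ ((k - 2) div 2))"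

definition double_almost_riordan ::
    "'a::field fps \<Rightarrow> 'a fps \<Rightarrow> 'a fps \<Rightarrow> 'a fps \<Rightarrow> nat \<Rightarrow> nat \<Rightarrow> 'a" where
  "double_almost_riordan b g f1 f2 n k = double_almost_riordan_column b g f1 f2 k $ n"

text \<open>The sum over all column indices is meaningful for matrices with finitely supported rows,
  in particular for lower triangular ones.\<close>

definition matrix_apply_fps :: "(nat \<Rightarrow> nat \<Rightarrow> 'a::field) \<Rightarrow> 'a fps \<Rightarrow> 'a fps" where
  "matrix_apply_fps D u = Abs_fps (\<lambda>n. Sum_any (\<lambda>k. D n k * u $ k))"

text \<open>For \<open>F $ 0 = 0\<close>, the next two series are \<open>\<Sum>k. u $ (2 * k) * F ^ k\<close> and
  \<open>\<Sum>k. u $ (2 * k + 1) * F ^ k\<close>. For even \<open>u\<close> the former is \<open>u(\<surd>F)\<close>, for odd \<open>u\<close> the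
  latter is \<open>u(\<surd>F) / \<surd>F\<close>; no square root of \<open>F\<close> needs to exist in the power series ring.\<close>

definition fps_even_at_sqrt :: "'a::field fps \<Rightarrow> 'a fps \<Rightarrow> 'a fps" where
  "fps_even_at_sqrt u F = Abs_fps (\<lambda>k. u $ (2 * k)) oo F"

definition fps_odd_at_sqrt_over_sqrt :: "'a::field fps \<Rightarrow> 'a fps \<Rightarrow> 'a fps" where
  "fps_odd_at_sqrt_over_sqrt u F = Abs_fps (\<lambda>k. u $ (2 * k + 1)) oo F"

lemma fps_even_at_sqrt_square:
  fixes u s :: "'a::field fps"
  assumes "fps_even u" "s $ 0 = 0"
  shows "fps_even_at_sqrt u (s ^ 2) = u oo s"
proof -
  have "u = Abs_fps (\<lambda>k. u $ (2 * k)) oo fps_X ^ 2"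
  proof (rule fps_ext)
    fix n
    have "((fps_X :: 'a fps) ^ 2) ^ i $ n = (if n = 2 * i then 1 else 0)" for i
      unfolding power_mult[symmetric] by simp
    then have "(Abs_fps (\<lambda>k. u $ (2 * k)) oo fps_X ^ 2) $ n =
          (\<Sum>i = 0..n. if n = 2 * i then u $ (2 * i) else 0)"
      by (auto simp: fps_compose_nth intro!: sum.cong)
    also have "\<dots> = u $ n"
    proof (cases "even n")
      case True
      then obtain m where m: "n = 2 * m" by blast
      have "(\<Sum>i = 0..n. if n = 2 * i then u $ (2 * i) else 0) =
            (\<Sum>i = 0..n. if i = m then u $ (2 * m) else 0)"
        by (rule sum.cong) (auto simp: m)
      then show ?thesis by (simp add: m)
    next
      case False
      then show ?thesis using assms(1) by (auto simp: fps_even_def intro!: sum.neutral)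
    qed
    finally show "u $ n = (Abs_fps (\<lambda>k. u $ (2 * k)) oo fps_X ^ 2) $ n" ..
  qed
  then have "u oo s = (Abs_fps (\<lambda>k. u $ (2 * k)) oo fps_X ^ 2) oo s" by simp
  also have "\<dots> = Abs_fps (\<lambda>k. u $ (2 * k)) oo (fps_X ^ 2 oo s)"
    by (rule fps_compose_assoc[symmetric]) (use assms in auto)
  also have "fps_X ^ 2 oo s = s ^ 2"
    using assms(2) by (simp add: power2_eq_square fps_compose_mult_distrib)
  finally show ?thesis by (simp add: fps_even_at_sqrt_def)
qed

lemma fps_odd_at_sqrt_over_sqrt_square:
  fixes u s :: "'a::field fps"
  assumes "fps_odd u" "s $ 0 = 0"
  shows "s * fps_odd_at_sqrt_over_sqrt u (s ^ 2) = u oo s"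
proof -
  define w where "w = fps_shift 1 u"
  have "u $ 0 = 0" using assms(1) by (auto simp: fps_odd_def)
  then have u: "u = fps_X * w"
    by (auto simp: w_def fps_eq_iff)
  have "fps_even w" using assms(1) by (auto simp: w_def fps_odd_def fps_even_def)
  from fps_even_at_sqrt_square[OF this assms(2)]
  have "w oo s = fps_odd_at_sqrt_over_sqrt u (s ^ 2)"
    by (simp add: fps_even_at_sqrt_def fps_odd_at_sqrt_over_sqrt_def w_def)
  then show ?thesis
    using assms(2) by (simp add: u fps_compose_mult_distrib)
qed

lemma double_almost_riordan_lower_triangular:
  fixes b g f1 f2 :: "'a::field fps"
  assumes "f1 $ 0 = 0" "f2 $ 0 = 0" "n < k"
  shows "double_almost_riordan b g f1 f2 n k = 0"
proof -
  obtain p q where f: "f1 = fps_X * p" "f2 = fps_X * q"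
  proof
    show "f1 = fps_X * fps_shift 1 f1" "f2 = fps_X * fps_shift 1 f2"
      using assms by (auto simp: fps_eq_iff)
  qed
  have "\<exists>r. double_almost_riordan_column b g f1 f2 k = fps_X ^ k * r"
  proof (cases "odd k")
    case True
    then obtain l where k: "k = 2 * l + 1" by (elim oddE)
    show ?thesis
      by (rule exI[of _ "g * (p * q) ^ l"])
         (simp add: double_almost_riordan_column_def k f power_mult_distrib power_mult
            power2_eq_square mult_ac)
  next
    case False
    then obtain l where k: "k = 2 * l + 2"
      using assms(3) by (metis Suc_pred add_2_eq_Suc' evenE gr0I less_nat_zero_code
          mult_Suc_right mult_is_0 add.commute)
    show ?thesis
      by (rule exI[of _ "g * p * (p * q) ^ l"])
         (simp add: double_almost_riordan_column_def k f power_mult_distrib power_mult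
            power2_eq_square mult_ac)
  qed
  then show ?thesis
    using assms(3) by (auto simp: double_almost_riordan_def fps_X_power_mult_nth)
qed

end

theory Submission
  imports Defs
begin

text \<open>The series \<open>v\<close> is the sum of the columns of \<open>D\<close> weighted by
  the coefficients of \<open>u\<close>, and lower triangularity makes this sum finite in each row.
  An even \<open>u\<close> selects column 0 and the columns
  \<open>fps_X * g * f1 * (f1 * f2) ^ l\<close>, an odd \<open>u\<close> the columns
  \<open>fps_X * g * (f1 * f2) ^ l\<close>. In both cases a common factor comes out and leaves a
  power series composed with \<open>f1 * f2\<close>. This is (b) at once; (a) follows since
  \<open>u(sqrt(f1 f2)) - u_0\<close> has the factor \<open>f1 * f2\<close>, whose \<open>f2\<close>
  cancels the denominator.\<close>

text \<open>Since \<open>F ^ k\<close> has no coefficient below index \<open>k\<close>, extra terms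
  vanish. A bound \<open>N\<close> independent of \<open>n\<close> lets the coefficients of a
  product share one range of summation.\<close>

lemma fps_compose_nth_sum_atMost:
  fixes a F :: "'a::field fps"
  assumes "F $ 0 = 0" "n \<le> N"
  shows "(a oo F) $ n = (\<Sum>k\<le>N. a $ k * (F ^ k) $ n)"
  unfolding fps_compose_nth
  by (rule sum.mono_neutral_left) (use assms startsby_zero_power_prefix[of F] in auto)

lemma fps_mult_compose_nth_sum_atMost:
  fixes a c F :: "'a::field fps"
  assumes "F $ 0 = 0" "n \<le> N"
  shows "(c * (a oo F)) $ n = (\<Sum>k\<le>N. (c * F ^ k) $ n * a $ k)"
proof -
  have "(c * (a oo F)) $ n = (\<Sum>j=0..n. c $ j * (\<Sum>k\<le>N. a $ k * (F ^ k) $ (n - j)))"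
    unfolding fps_mult_nth
    by (intro sum.cong refl arg_cong2[where f = "(*)"] fps_compose_nth_sum_atMost)
       (use assms in auto)
  also have "\<dots> = (\<Sum>j=0..n. \<Sum>k\<le>N. c $ j * (F ^ k) $ (n - j) * a $ k)"
    by (simp add: sum_distrib_left mult_ac)
  also have "\<dots> = (\<Sum>k\<le>N. \<Sum>j=0..n. c $ j * (F ^ k) $ (n - j) * a $ k)"
    by (rule sum.swap)
  finally show ?thesis
    by (simp add: fps_mult_nth sum_distrib_right)
qed

text \<open>\<open>Sum_any\<close> is a genuine sum only for finite support, which \<open>S\<close>
  guarantees.\<close>

lemma matrix_apply_fps_nth:
  assumes "finite S" "\<And>k. k \<notin> S \<Longrightarrow> D n k * u $ k = 0"
  shows "matrix_apply_fps D u $ n = (\<Sum>k\<in>S. D n k * u $ k)"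
  using Sum_any.expand_superset[OF assms(1), of "\<lambda>k. D n k * u $ k"] assms(2)
  by (auto simp: matrix_apply_fps_def)

text \<open>A form of (a) without division: the weighted columns \<open>2 * l + 2\<close> share the
  factor \<open>fps_X * g * f1\<close>.\<close>

lemma double_almost_riordan_apply_even:
  fixes b g f1 f2 u :: "'a::field fps"
  assumes "f1 $ 0 = 0" "f2 $ 0 = 0" "fps_even u"
  shows "matrix_apply_fps (double_almost_riordan b g f1 f2) u =
    fps_const (u $ 0) * b + fps_X * g * f1 * (Abs_fps (\<lambda>k. u $ (2 * k + 2)) oo (f1 * f2))"
proof (rule fps_ext)
  fix n :: nat
  define S where "S = (\<lambda>l::nat. 2 * l + 2) ` {..n}"
  let ?D = "double_almost_riordan b g f1 f2"
  have vanish: "?D n k * u $ k = 0" if "k \<notin> insert 0 S" for k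
  proof (cases "even k")
    case True
    then obtain m where m: "k = 2 * m" by (elim evenE)
    with that obtain l where "m = Suc l" by (cases m) auto
    with m have k: "k = 2 * l + 2" by simp
    with that have "n < k" by (auto simp: S_def)
    then show ?thesis using double_almost_riordan_lower_triangular assms by auto
  next
    case False
    then show ?thesis using assms(3) by (auto simp: fps_even_def)
  qed
  have "matrix_apply_fps ?D u $ n = (\<Sum>k\<in>insert 0 S. ?D n k * u $ k)"
    by (rule matrix_apply_fps_nth) (use vanish in \<open>auto simp: S_def\<close>)
  also have "\<dots> = b $ n * u $ 0 + (\<Sum>k\<in>S. ?D n k * u $ k)"
    by (subst sum.insert)
       (auto simp: S_def double_almost_riordan_def double_almost_riordan_column_def)
  also have "(\<Sum>k\<in>S. ?D n k * u $ k) =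
      (\<Sum>l\<le>n. (fps_X * g * f1 * (f1 * f2) ^ l) $ n * Abs_fps (\<lambda>k. u $ (2 * k + 2)) $ l)"
    unfolding S_def
    by (subst sum.reindex)
       (auto simp: inj_on_def double_almost_riordan_def double_almost_riordan_column_def)
  also have "\<dots> = (fps_X * g * f1 * (Abs_fps (\<lambda>k. u $ (2 * k + 2)) oo (f1 * f2))) $ n"
    by (rule fps_mult_compose_nth_sum_atMost[symmetric]) (use assms in auto)
  finally show "matrix_apply_fps ?D u $ n = (fps_const (u $ 0) * b +
      fps_X * g * f1 * (Abs_fps (\<lambda>k. u $ (2 * k + 2)) oo (f1 * f2))) $ n"
    by (simp add: mult.commute)
qed

lemma double_almost_riordan_apply_odd:
  fixes b g f1 f2 u :: "'a::field fps"
  assumes "f1 $ 0 = 0" "f2 $ 0 = 0" "fps_odd u"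
  shows "matrix_apply_fps (double_almost_riordan b g f1 f2) u =
    fps_X * g * fps_odd_at_sqrt_over_sqrt u (f1 * f2)"
proof (rule fps_ext)
  fix n :: nat
  \<comment> \<open>No index is kept apart here: \<open>u $ 0 = 0\<close> removes column
    \<open>b\<close>.\<close>
  define S where "S = (\<lambda>l::nat. 2 * l + 1) ` {..n}"
  let ?D = "double_almost_riordan b g f1 f2"
  have vanish: "?D n k * u $ k = 0" if "k \<notin> S" for k
  proof (cases "odd k")
    case True
    then obtain l where k: "k = 2 * l + 1" by (elim oddE)
    with that have "n < k" by (auto simp: S_def)
    then show ?thesis using double_almost_riordan_lower_triangular assms by auto
  next
    case False
    then show ?thesis using assms(3) by (auto simp: fps_odd_def)
  qed
  have "matrix_apply_fps ?D u $ n = (\<Sum>k\<in>S. ?D n k * u $ k)"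
    by (rule matrix_apply_fps_nth) (use vanish in \<open>auto simp: S_def\<close>)
  also have "\<dots> =
      (\<Sum>l\<le>n. (fps_X * g * (f1 * f2) ^ l) $ n * Abs_fps (\<lambda>k. u $ (2 * k + 1)) $ l)"
    unfolding S_def
    by (subst sum.reindex)
       (auto simp: inj_on_def double_almost_riordan_def double_almost_riordan_column_def)
  also have "\<dots> = (fps_X * g * (Abs_fps (\<lambda>k. u $ (2 * k + 1)) oo (f1 * f2))) $ n"
    by (rule fps_mult_compose_nth_sum_atMost[symmetric]) (use assms in auto)
  finally show "matrix_apply_fps ?D u $ n =
      (fps_X * g * fps_odd_at_sqrt_over_sqrt u (f1 * f2)) $ n"
    by (simp add: fps_odd_at_sqrt_over_sqrt_def)
qed

text \<open>Split off the constant term of the coefficient series before composing; the remaining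
  factor \<open>fps_X\<close> becomes \<open>F\<close>.\<close>

lemma fps_even_at_sqrt_minus_const:
  fixes u F :: "'a::field fps"
  assumes "F $ 0 = 0"
  shows "fps_even_at_sqrt u F - fps_const (u $ 0) = F * (Abs_fps (\<lambda>k. u $ (2 * k + 2)) oo F)"
proof -
  have "Abs_fps (\<lambda>k. u $ (2 * k)) = fps_const (u $ 0) + fps_X * Abs_fps (\<lambda>k. u $ (2 * k + 2))"
    by (rule fps_ext) (auto simp: algebra_simps gr0_conv_Suc)
  then show ?thesis
    using assms
    by (simp add: fps_even_at_sqrt_def fps_compose_add_distrib fps_compose_mult_distrib)
qed

theorem theorem2p2:
  fixes b g f1 f2 u :: "'a::field_char_0 fps"
  assumes "b $ 0 \<noteq> 0" and "g $ 0 \<noteq> 0" and "fps_even g"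
    and "fps_odd f1" and "f1 $ 1 \<noteq> 0"
    and "fps_odd f2" and "f2 $ 1 \<noteq> 0"
  shows "(fps_even u \<longrightarrow>
            matrix_apply_fps (double_almost_riordan b g f1 f2) u =
              fps_const (u $ 0) * b +
              (fps_X * g / f2) * (fps_even_at_sqrt u (f1 * f2) - fps_const (u $ 0))) \<and>
         (fps_odd u \<longrightarrow>
            matrix_apply_fps (double_almost_riordan b g f1 f2) u =
              fps_X * g * fps_odd_at_sqrt_over_sqrt u (f1 * f2))"
proof -
  have zero: "f1 $ 0 = 0" "f2 $ 0 = 0"
    using assms by (auto simp: fps_odd_def)
  have "subdegree f2 = 1"
    using assms(7) zero(2) by (intro subdegreeI) auto
  moreover have "f2 \<noteq> 0" "g \<noteq> 0"
    using assms(2,7) by auto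
  \<comment> \<open>Divisibility compares orders: \<open>f2\<close> has order 1 and
    \<open>fps_X * g\<close> at least 1. Hence the quotient is exact, and multiplying it by
    \<open>f1 * f2\<close> gives \<open>fps_X * g * f1\<close>.\<close>
  ultimately have "f2 dvd fps_X * g"
    by (simp add: fps_dvd_iff)
  then have "fps_X * g / f2 * f2 = fps_X * g"
    by (rule dvd_div_mult_self)
  then show ?thesis
    using zero
    by (simp add: double_almost_riordan_apply_even double_almost_riordan_apply_odd
        fps_even_at_sqrt_minus_const)
qed

end
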